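(* Let $N\in\mathbb{N}\cup\{0\}$ and let $f:\mathbb{N}\to\mathbb{N}$ be a polynomial function of the form $f(x)=\sum_{k=0}^{N}a_kx^k$ with $a_0,a_1,\dots,a_N\in\mathbb{N}\cup\{0\}$. Then $f$ is continuous as a map $M(\mathbb{N})\to M(\mathbb{N})$ if and only if there exist $a\in\mathbb{N}$ and $n\in\mathbb{N}\cup\{0\}$ such that $f(x)=ax^n$ for all $x\in\mathbb{N}$.
   Context: $\mathbb{N}$ denotes the set of positive integers. For $n\in\mathbb{N}$ put $\sigma_n:=\{m\in\mathbb{N}:\gcd(n,m)=1\}$. The Macías space $M(\mathbb{N})$ is the topological space $(\mathbb{N},\tau_M)$, where $\tau_M$ is the topology generated by the collection $\{\sigma_n:n\in\mathbb{N}\}$ (this collection is a base of $\tau_M$, since $\sigma_{nm}=\sigma_n\cap\sigma_m$ and $\sigma_1=\mathbb{N}$). *)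

theory Defs
  imports "HOL-Analysis.Analysis"
begin

text \<open>The positive integers are the subset \<open>{0<..}\<close> of \<^typ>\<open>nat\<close>. They form the
  carrier of the space below; the value of a function at \<open>0\<close> is irrelevant.\<close>

definition sigma_coprime :: "nat \<Rightarrow> nat set" where
  "sigma_coprime n = {m \<in> {0<..}. gcd n m = 1}"

definition macias :: "nat topology" where
  "macias = topology_generated_by {sigma_coprime n | n. n \<in> {0<..}}"

lemma topspace_macias: "topspace macias = {0<..}"
proof -
  have "sigma_coprime 1 = {0<..}"
    by (auto simp: sigma_coprime_def)
  then have "{0<..} \<in> {sigma_coprime n | n. n \<in> {0<..}}"
    by (force intro: exI[of _ 1])
  moreover have "sigma_coprime n \<subseteq> {0<..}" for n
    by (auto simp: sigma_coprime_def)
  ultimately show ?thesis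
    unfolding macias_def topology_generated_by_topspace by blast
qed

end

theory Submission
  imports Defs "HOL-Number_Theory.Number_Theory"
begin

text \<open>
  Every open set containing \<open>x\<close> contains all positive integers whose prime divisors divide
  \<open>x\<close>. A continuous map must respect this relation, so for continuous \<open>f\<close> the values
  \<open>f (2 ^ k)\<close> with \<open>k \<ge> 1\<close> involve only the finitely many primes that divide \<open>f 2\<close>
  (\<open>continuous_macias_coprime\<close>). A polynomial with this property is a monomial. Indeed, write
  \<open>f x = x ^ n * g x\<close> with \<open>g 0 \<noteq> 0\<close>, and choose a highly divisible exponent \<open>k\<close>. Then
  \<open>2 ^ k\<close> is close to \<open>0\<close> in the 2-adic sense and close to \<open>1\<close> in the \<open>q\<close>-adic sense for each
  of the other primes \<open>q\<close> involved, so the exponents of these primes in \<open>g (2 ^ k)\<close> are at most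
  their exponents in \<open>g 0\<close> and \<open>g 1\<close> respectively. Hence \<open>g (2 ^ k)\<close> divides \<open>g 0 * g 1\<close> for
  arbitrarily large \<open>k\<close> (\<open>value_at_power_dvd\<close>), which is impossible for a nonconstant \<open>g\<close> with
  nonnegative coefficients, as it tends to infinity.

  Conversely, a prime dividing \<open>c * x ^ n\<close> divides \<open>c\<close> or \<open>x\<close>, so under a monomial every basic
  open set pulls back to a basic open set, the empty set or the whole space.
\<close>

section \<open>Open sets and continuous maps of the Macias space\<close>

lemma mem_sigma_coprime: "x \<in> sigma_coprime m \<longleftrightarrow> 0 < x \<and> coprime m x"
  unfolding sigma_coprime_def coprime_iff_gcd_eq_1 by blast

lemma openin_sigma_coprime:
  assumes "0 < m"
  shows "openin macias (sigma_coprime m)"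
  unfolding macias_def using assms by (intro topology_generated_by_Basis) auto

text \<open>Each \<open>sigma_coprime m\<close> has this property, and it survives finite intersections and
  arbitrary unions, so it passes to the generated topology. It says that \<open>x\<close> lies in the closure
  of every \<open>y\<close> whose prime divisors all divide \<open>x\<close>.\<close>

lemma openin_macias_coprime:
  assumes "openin macias U" "x \<in> U" "0 < y" "\<And>m. coprime m x \<Longrightarrow> coprime m y"
  shows "y \<in> U"
proof -
  have "generate_topology_on {sigma_coprime n |n. n \<in> {0<..}} U"
    using assms(1) unfolding macias_def by (rule openin_topology_generated_by)
  then show ?thesis
    using assms(2)
  proof induction
    case (Basis s)
    then show ?case
      using assms(3,4) by (auto simp: mem_sigma_coprime)
  qed blast+
qed

lemma continuous_macias_coprime:
  assumes cont: "continuous_map macias macias f"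
    and pos: "0 < x" "0 < y" and xy: "\<And>m. coprime m x \<Longrightarrow> coprime m y"
    and m: "0 < m" "coprime m (f x)"
  shows "coprime m (f y)"
proof -
  let ?U = "{z \<in> topspace macias. f z \<in> sigma_coprime m}"
  have "openin macias ?U"
    using cont openin_sigma_coprime[OF m(1)] by (rule openin_continuous_map_preimage)
  moreover have "0 < f x"
    using continuous_map_funspace[OF cont] pos(1) by (simp add: topspace_macias Pi_iff)
  then have "x \<in> ?U"
    using pos m(2) by (simp add: topspace_macias mem_sigma_coprime)
  ultimately have "y \<in> ?U"
    by (rule openin_macias_coprime[OF _ _ pos(2) xy])
  then show ?thesis
    by (simp add: mem_sigma_coprime)
qed

lemma continuous_macias_monomial:
  assumes c: "0 < c"
  shows "continuous_map macias macias (\<lambda>x. c * x ^ n)"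
proof -
  have "openin macias ((\<lambda>x. c * x ^ n) -` sigma_coprime m \<inter> {0<..})" if m: "0 < m" for m
  proof -
    have "(\<lambda>x. c * x ^ n) -` sigma_coprime m \<inter> {0<..} =
      (if \<not> coprime m c then {} else if n = 0 then {0<..} else sigma_coprime m)"
      using c by (auto simp: mem_sigma_coprime)
    then show ?thesis
      using openin_sigma_coprime[OF m] openin_topspace[of macias] by (simp add: topspace_macias)
  qed
  moreover have "\<Union>{sigma_coprime n |n. n \<in> {0<..}} = {0<..}"
    using topspace_macias unfolding macias_def topology_generated_by_topspace .
  then have "(\<lambda>x. c * x ^ n) ` topspace macias \<subseteq> \<Union>{sigma_coprime n |n. n \<in> {0<..}}"
    unfolding topspace_macias using c by (simp only: image_subset_iff) simp
  ultimately have "continuous_map macias (topology_generated_by {sigma_coprime n |n. n \<in> {0<..}})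
      (\<lambda>x. c * x ^ n)"
    unfolding continuous_on_generated_topo_iff topspace_macias by blast
  then show ?thesis
    by (simp only: macias_def)
qed

section \<open>Values of a polynomial at powers\<close>

text \<open>The modulus is the first power of \<open>q\<close> that does not divide \<open>v\<close>; a number congruent to \<open>v\<close>
  is not divisible by it either.\<close>

lemma multiplicity_le_if_cong:
  fixes q u v :: nat
  assumes "prime q" "0 < v" "[u = v] (mod q ^ Suc (multiplicity q v))"
  shows "multiplicity q u \<le> multiplicity q v"
proof -
  have "v \<noteq> 0" "\<not> is_unit q"
    using assms(1,2) not_prime_unit by auto
  then have "\<not> q ^ Suc (multiplicity q v) dvd v"
    using power_dvd_iff_le_multiplicity[of v q "Suc (multiplicity q v)"] by simp
  then have "\<not> q ^ Suc (multiplicity q v) dvd u"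
    using cong_dvd_iff[OF assms(3)] by simp
  then show ?thesis
    using multiplicity_dvd'[of "Suc (multiplicity q v)" q u] by linarith
qed

text \<open>The exponent is \<open>K = fact M\<close> because \<open>x ^ K\<close> is then congruent to \<open>1\<close> modulo every integer
  up to \<open>M\<close> that is coprime to \<open>x\<close>, by Euler's theorem. The bound \<open>D\<close> on the primes involved makes
  one \<open>M\<close> sufficient for all of them. Preserving congruences is the only feature of
  polynomials that matters here.\<close>

lemma value_at_power_dvd:
  fixes g :: "nat \<Rightarrow> nat"
  assumes g_cong: "\<And>m u v. [u = v] (mod m) \<Longrightarrow> [g u = g v] (mod m)"
    and pos: "0 < g 0" "0 < g 1" "0 < D"
    and primes: "\<And>q k. prime q \<Longrightarrow> 0 < k \<Longrightarrow> q dvd g (x ^ k) \<Longrightarrow> q dvd D"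
    and nz: "\<And>k. g (x ^ k) \<noteq> 0"
  obtains K where "B \<le> K" "g (x ^ K) dvd g 0 * g 1"
proof
  define M where "M = B + g 0 + D * g 1"
  let ?K = "fact M :: nat"
  have K: "M \<le> ?K"
    by (rule fact_ge_self)
  then show "B \<le> ?K"
    by (simp add: M_def)
  show "g (x ^ ?K) dvd g 0 * g 1"
  proof (rule multiplicity_le_imp_dvd)
    fix q :: nat
    assume q: "prime q"
    have mult: "multiplicity q (g 0 * g 1) = multiplicity q (g 0) + multiplicity q (g 1)"
      using q pos by (intro prime_elem_multiplicity_mult_distrib) auto
    consider "\<not> q dvd g (x ^ ?K)" | "q dvd x" | "q dvd g (x ^ ?K)" "\<not> q dvd x"
      by blast
    then show "multiplicity q (g (x ^ ?K)) \<le> multiplicity q (g 0 * g 1)"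
    proof cases
      case 1
      then show ?thesis
        by (simp add: not_dvd_imp_multiplicity_0)
    next
      case 2
      let ?v = "multiplicity q (g 0)"
      have "?v < q ^ ?v"
        using q by (intro power_gt_expt prime_gt_Suc_0_nat)
      also have "\<dots> \<le> g 0"
        using pos by (intro dvd_imp_le multiplicity_dvd)
      finally have "Suc ?v \<le> ?K"
        using K by (simp add: M_def)
      then have "q ^ Suc ?v dvd x ^ ?K"
        using 2 by (meson dvd_power_same le_imp_power_dvd dvd_trans)
      then have "[g (x ^ ?K) = g 0] (mod q ^ Suc ?v)"
        by (intro g_cong) (simp add: cong_0_iff)
      then show ?thesis
        using multiplicity_le_if_cong[OF q pos(1)] mult by fastforce
    next
      case 3
      let ?m = "q ^ Suc (multiplicity q (g 1))"
      have "q dvd D"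
        using primes[OF q _ 3(1)] by simp
      then have "?m dvd D * g 1"
        by (simp add: mult_dvd_mono multiplicity_dvd)
      then have "?m \<le> M"
        using pos by (auto dest: dvd_imp_le simp: M_def)
      then have "totient ?m dvd ?K"
        using totient_le[of ?m] q by (intro dvd_fact) (auto simp: prime_gt_0_nat Suc_le_eq)
      then obtain l where l: "?K = totient ?m * l" ..
      have "coprime x ?m"
        using 3(2) q by (metis coprime_commute coprime_power_left_iff prime_imp_coprime)
      then have "[(x ^ totient ?m) ^ l = 1 ^ l] (mod ?m)"
        by (intro cong_pow euler_theorem)
      then have "[x ^ ?K = 1] (mod ?m)"
        by (simp only: l power_mult power_one)
      then have "[g (x ^ ?K) = g 1] (mod ?m)"
        by (rule g_cong)
      then show ?thesis
        using multiplicity_le_if_cong[OF q pos(2)] mult by fastforce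
    qed
  qed (rule nz)
qed

section \<open>Continuous polynomials\<close>

text \<open>The trailing coefficient \<open>a n\<close> is split off so that the second factor does not vanish at
  \<open>0\<close>.\<close>

lemma polynomial_split_trailing:
  fixes a :: "nat \<Rightarrow> nat"
  assumes "0 < (\<Sum>k=0..N. a k)"
  obtains n where "n \<le> N" "0 < a n"
    "\<And>x. (\<Sum>k=0..N. a k * x ^ k) = x ^ n * (\<Sum>k=0..N - n. a (n + k) * x ^ k)"
proof -
  have ex: "\<exists>k. k \<le> N \<and> 0 < a k"
    using assms by (metis atLeastAtMost_iff gr0I less_irrefl sum.neutral)
  define n where "n = (LEAST k. k \<le> N \<and> 0 < a k)"
  have n: "n \<le> N" "0 < a n"
    using LeastI_ex[OF ex] by (simp_all add: n_def)
  have below: "a k = 0" if "k < n" for k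
    using not_less_Least[of k "\<lambda>k. k \<le> N \<and> 0 < a k"] that n(1) by (auto simp: n_def)
  have "(\<Sum>k=0..N. a k * x ^ k) = x ^ n * (\<Sum>k=0..N - n. a (n + k) * x ^ k)" for x
  proof -
    have "(\<Sum>k=0..N. a k * x ^ k) = (\<Sum>k=n..N. a k * x ^ k)"
      by (rule sum.mono_neutral_right) (auto simp: below)
    also have "\<dots> = (\<Sum>k=0..N - n. a (n + k) * x ^ (n + k))"
      using n(1) by (intro sum.reindex_bij_witness[of _ "\<lambda>k. n + k" "\<lambda>k. k - n"]) auto
    finally show ?thesis
      by (simp add: sum_distrib_left power_add ac_simps)
  qed
  with n that show thesis
    by blast
qed

theorem theorem3p12:
  fixes N :: nat and a :: "nat \<Rightarrow> nat" and f :: "nat \<Rightarrow> nat"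
  assumes "f \<in> {0<..} \<rightarrow> {0<..}"
    and "\<And>x. x \<in> {0<..} \<Longrightarrow> f x = (\<Sum>k=0..N. a k * x ^ k)"
  shows "continuous_map macias macias f \<longleftrightarrow>
    (\<exists>c\<in>{0<..}. \<exists>n. \<forall>x\<in>{0<..}. f x = c * x ^ n)"
proof
  assume cont: "continuous_map macias macias f"
  have fpos: "0 < f x" if "0 < x" for x
    using assms(1) that by auto
  have "0 < (\<Sum>k=0..N. a k)"
    using fpos[of 1] assms(2)[of 1] by simp
  then obtain n where n: "n \<le> N" "0 < a n" and
    split: "\<And>x. (\<Sum>k=0..N. a k * x ^ k) = x ^ n * (\<Sum>k=0..N - n. a (n + k) * x ^ k)"
    using polynomial_split_trailing by blast
  define g where "g x = (\<Sum>k=0..N - n. a (n + k) * x ^ k)" for x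
  have fg: "f x = x ^ n * g x" if "0 < x" for x
    using assms(2)[of x] that split by (simp add: g_def)
  have g0: "g 0 = a n"
    by (simp add: g_def power_0_left sum.delta if_distrib cong: if_cong)
  have gpos: "0 < g x" if "0 < x" for x
    using fpos[OF that] fg[OF that] by (cases "g x = 0") auto
  have g_cong: "[g u = g v] (mod m)" if "[u = v] (mod m)" for u v m
    unfolding g_def using that by (intro cong_sum cong_mult cong_pow cong_refl)
  have primes: "q dvd f 2" if q: "prime q" "0 < k" "q dvd g (2 ^ k)" for q k
  proof (rule ccontr)
    assume "\<not> q dvd f 2"
    then have "coprime q (f 2)"
      using q(1) by (simp add: prime_imp_coprime)
    then have "coprime q (f (2 ^ k))"
      using q by (intro continuous_macias_coprime[OF cont, of 2 "2 ^ k"]) (auto simp: prime_gt_0_nat)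
    moreover have "q dvd f (2 ^ k)"
      using q(3) fg[of "2 ^ k"] by simp
    ultimately show False
      using q(1) by (meson coprime_absorb_left not_prime_unit)
  qed
  \<comment> \<open>The lower bound on \<open>K\<close> makes \<open>2 ^ K\<close> exceed every divisor of \<open>g 0 * g 1\<close>, in particular
    \<open>g (2 ^ K)\<close>, whereas any nonzero coefficient of \<open>g\<close> in positive degree would give
    \<open>2 ^ K \<le> g (2 ^ K)\<close>.\<close>
  obtain K where K: "g 0 * g 1 \<le> K" "g (2 ^ K) dvd g 0 * g 1"
    by (rule value_at_power_dvd[of g "f 2" 2 "g 0 * g 1"])
      (use g_cong g0 n gpos fpos primes in \<open>auto simp: less_imp_neq[symmetric]\<close>)
  have small: "g (2 ^ K) < 2 ^ K"
  proof -
    have "g (2 ^ K) \<le> g 0 * g 1"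
      using K(2) g0 n gpos[of 1] by (intro dvd_imp_le) auto
    also have "\<dots> < 2 ^ K"
      using K(1) less_exp[of K] by linarith
    finally show ?thesis .
  qed
  have higher: "a (n + j) = 0" if j: "0 < j" "j \<le> N - n" for j
  proof (rule ccontr)
    assume "a (n + j) \<noteq> 0"
    then have "2 ^ K \<le> a (n + j) * ((2::nat) ^ K) ^ j"
      using j(1) self_le_power[of "2 ^ K :: nat" j] by (simp add: trans_le_add1 le_trans)
    also have "\<dots> \<le> g (2 ^ K)"
      unfolding g_def using j(2) by (intro member_le_sum) auto
    finally show False
      using small by simp
  qed
  have "g x = a n" for x
  proof -
    have "g x = (\<Sum>k\<in>{0}. a (n + k) * x ^ k)"
      unfolding g_def using higher by (intro sum.mono_neutral_right) auto
    then show ?thesis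
      by simp
  qed
  then show "\<exists>c\<in>{0<..}. \<exists>n. \<forall>x\<in>{0<..}. f x = c * x ^ n"
    using n(2) fg by (intro bexI[of _ "a n"] exI[of _ n]) auto
next
  assume "\<exists>c\<in>{0<..}. \<exists>n. \<forall>x\<in>{0<..}. f x = c * x ^ n"
  then obtain c n where c: "0 < c" and f: "\<And>x. 0 < x \<Longrightarrow> f x = c * x ^ n"
    by auto
  show "continuous_map macias macias f"
    using continuous_macias_monomial[OF c, of n]
    by (rule continuous_map_eq) (simp add: f topspace_macias)
qed

end
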